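(* Let $n\ge 2$ be an integer. Then there exists $\alpha_0>0$ such that for every $\alpha\in\mathbb{R}$ with $\alpha>\alpha_0$ the immediate basin of attraction $A_{n,\alpha}^{*}(1)$ of the fixed point $z=1$ of $O_{n,\alpha}$ is infinitely connected. Moreover, for $n=2$, $A_{2,\alpha}^{*}(1)$ is infinitely connected for every $\alpha\in\mathbb{C}$ such that $|\alpha|>\alpha_0$.
   Context: $\hat{\mathbb{C}}$ denotes the Riemann sphere. For an integer $n\ge 2$ and $\alpha\in\mathbb{C}$, $O_{n,\alpha}:\hat{\mathbb{C}}\to\hat{\mathbb{C}}$ is the rational map obtained by applying the Chebyshev–Halley root-finding method with parameter $\alpha$ to $f_n(z)=z^n-1$, i.e. $$O_{n,\alpha}(z)=z-\left(1+\frac12\,\frac{L(z)}{1-\alpha L(z)}\right)\frac{f_n(z)}{f_n'(z)},\qquad L(z)=\frac{f_n(z)f_n''(z)}{(f_n'(z))^2},$$ explicitly $$O_{n,\alpha}(z)=\frac{(1-2\alpha)(n-1)+(2-4\alpha-4n+6\alpha n-2\alpha n^2)z^n+(n-1)(1-2\alpha-2n+2\alpha n)z^{2n}}{2nz^{n-1}\left(\alpha(1-n)+(-\alpha-n+\alpha n)z^n\right)}.$$ The point $z=1$ is a superattracting fixed point of $O_{n,\alpha}$. Its basin of attraction is $\{z\in\hat{\mathbb{C}}: \lim_{k\to\infty}O_{n,\alpha}^k(z)=1\}$ and $A_{n,\alpha}^{*}(1)$, the immediate basin, is its connected component containing $1$. An open connected subset of $\hat{\mathbb{C}}$ is infinitely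 connected if its complement in $\hat{\mathbb{C}}$ has infinitely many connected components. *)

theory Defs
  imports
    "HOL-Analysis.Analysis"
    "HOL-Computational_Algebra.Computational_Algebra"
    "HOL-Computational_Algebra.Field_as_Ring"
begin

section \<open>The Riemann sphere\<close>

text \<open>The point at infinity is \<^term>\<open>None\<close>, and \<open>Some z\<close> is the finite point \<open>z\<close>.\<close>

definition riemann_sphere :: "complex option topology" where
  "riemann_sphere = Alexandroff_compactification euclidean"

lemma topspace_riemann_sphere [simp]: "topspace riemann_sphere = UNIV"
  by (simp add: riemann_sphere_def UNIV_option_conv)

text \<open>
  The self-map of the sphere given by a rational function. Since \<^const>\<open>quot_of_fract\<close>
  returns a coprime numerator \<open>p\<close> and denominator \<open>q\<close>, a zero of \<open>q\<close> is a pole. At infinity the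
  value is the limit of \<open>p z / q z\<close>, which is \<open>0\<close> when \<open>degree p < degree q\<close>.
\<close>

definition rational_map :: "complex poly fract \<Rightarrow> complex option \<Rightarrow> complex option" where
  "rational_map r x =
     (let (p, q) = quot_of_fract r in
      case x of
        Some z \<Rightarrow> if poly q z = 0 then None else Some (poly p z / poly q z)
      | None \<Rightarrow> if degree p > degree q then None
                else Some (coeff p (degree q) / lead_coeff q))"

section \<open>The Chebyshev--Halley family\<close>

text \<open>
  The method is computed in the field of rational functions: \<open>to_fract [:\<alpha>:]\<close> is the constant
  \<open>\<alpha>\<close>, and \<open>to_fract [:0, 1:]\<close> is the identity function.
\<close>

definition chebyshev_halley :: "complex \<Rightarrow> complex poly \<Rightarrow> complex poly fract" where
  "chebyshev_halley \<alpha> f =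
     (let F = to_fract f; F' = to_fract (pderiv f); F'' = to_fract (pderiv (pderiv f));
          L = F * F'' / F'\<^sup>2
      in to_fract [:0, 1:] - (1 + 1 / 2 * (L / (1 - to_fract [:\<alpha>:] * L))) * (F / F'))"

definition ch_map :: "nat \<Rightarrow> complex \<Rightarrow> complex option \<Rightarrow> complex option" where
  "ch_map n \<alpha> = rational_map (chebyshev_halley \<alpha> (monom 1 n - 1))"

lemma chebyshev_halley_field_identity:
  fixes x y c a :: "'a::field"
  defines "w \<equiv> x\<^sup>2 * y"
  defines "L \<equiv> (w - 1) * (c * (c - 1) * y) / (c * (x * y))\<^sup>2"
  defines "D \<equiv> a * (1 - c) + (- a - c + a * c) * w"
  assumes nz: "x \<noteq> 0" "y \<noteq> 0" "c \<noteq> 0" "D \<noteq> 0" "(2::'a) \<noteq> 0"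
  shows "x - (1 + 1 / 2 * (L / (1 - a * L))) * ((w - 1) / (c * (x * y))) =
    ((1 - 2 * a) * (c - 1) + (2 - 4 * a - 4 * c + 6 * a * c - 2 * a * c\<^sup>2) * w
      + (c - 1) * (1 - 2 * a - 2 * c + 2 * a * c) * w\<^sup>2) / (2 * c * (x * y) * D)"
proof -
  have w: "w \<noteq> 0" and xy: "x * y = w / x"
    using nz by (simp_all add: w_def power2_eq_square)
  have L: "L = (w - 1) * (c - 1) / (c * w)"
    using nz by (simp add: L_def w_def power2_eq_square field_simps)
  have "1 - a * L = - D / (c * w)"
    using nz w by (simp add: L D_def divide_simps) (simp add: algebra_simps)
  then have "L / (1 - a * L) = - ((w - 1) * (c - 1) / D)"
    using nz w by (simp add: L)
  then have "x - (1 + 1 / 2 * (L / (1 - a * L))) * ((w - 1) / (c * (x * y))) =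
      x - (1 - (w - 1) * (c - 1) / (2 * D)) * ((w - 1) * x / (c * w))"
    using nz w by (simp add: xy)
  also have "\<dots> = x * (2 * D * (c * w) - (2 * D - (w - 1) * (c - 1)) * (w - 1)) / (2 * D * (c * w))"
    using nz w by (simp add: divide_simps) (simp add: algebra_simps)
  also have "2 * D * (c * w) - (2 * D - (w - 1) * (c - 1)) * (w - 1) =
      (1 - 2 * a) * (c - 1) + (2 - 4 * a - 4 * c + 6 * a * c - 2 * a * c\<^sup>2) * w
      + (c - 1) * (1 - 2 * a - 2 * c + 2 * a * c) * w\<^sup>2"
    unfolding D_def by algebra
  finally show ?thesis
    using nz w by (simp add: xy mult_ac)
qed

lemma to_fract_power: "to_fract (p ^ k) = to_fract p ^ k"
  by (induction k) simp_all

lemma chebyshev_halley_explicit: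
  fixes n :: nat and \<alpha> :: complex
  assumes n: "n \<ge> 2"
  defines "N \<equiv> of_nat n"
  shows "chebyshev_halley \<alpha> (monom 1 n - 1) =
    Fract
      ([:(1 - 2 * \<alpha>) * (N - 1):]
        + monom (2 - 4 * \<alpha> - 4 * N + 6 * \<alpha> * N - 2 * \<alpha> * N ^ 2) n
        + monom ((N - 1) * (1 - 2 * \<alpha> - 2 * N + 2 * \<alpha> * N)) (2 * n))
      (monom (2 * N) (n - 1) * ([:\<alpha> * (1 - N):] + monom (- \<alpha> - N + \<alpha> * N) n))"
proof -
  define m where "m = n - 2"
  have m: "n = Suc (Suc m)" using n by (simp add: m_def)
  define x y c a where "x = to_fract [:0, 1::complex:]" and "y = x ^ m"
    and "c = to_fract [:N:]" and "a = to_fract [:\<alpha>:]"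
  have mon: "to_fract (monom b k) = to_fract [:b:] * x ^ k" for b k
  proof -
    have "monom b k = [:b:] * [:0, 1:] ^ k" by (simp add: monom_altdef)
    then show ?thesis by (simp only: to_fract_mult to_fract_power x_def)
  qed
  have N: "N \<noteq> 0" using n by (simp add: N_def)
  have one: "to_fract [:1::complex:] = 1" by (metis one_pCons to_fract_1)
  have two: "to_fract [:2::complex:] = 2"
    by (metis numeral_poly one_add_one to_fract_1 to_fract_add)
  note [simp del] = mult_pCons_left mult_pCons_right
  have add: "to_fract [:u + v:] = to_fract [:u:] + to_fract [:v:]"
    and diff: "to_fract [:u - v:] = to_fract [:u:] - to_fract [:v:]"
    and neg: "to_fract [:- u:] = - to_fract [:u:]"
    and mult: "to_fract [:u * v:] = to_fract [:u:] * to_fract [:v:]" for u v :: complex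
  proof -
    show "to_fract [:u + v:] = to_fract [:u:] + to_fract [:v:]" by (simp flip: to_fract_add)
    show "to_fract [:u - v:] = to_fract [:u:] - to_fract [:v:]" by (simp flip: to_fract_diff)
    show "to_fract [:- u:] = - to_fract [:u:]" by (simp flip: to_fract_uminus)
    show "to_fract [:u * v:] = to_fract [:u:] * to_fract [:v:]"
      by (simp add: mult_pCons_left flip: to_fract_mult)
  qed
  have four: "to_fract [:4::complex:] = 4" and six: "to_fract [:6::complex:] = 6"
    using add[of 2 2] add[of 4 2] by (simp_all add: two)
  note hom = add diff neg mult one two four six
  define q where "q = [:\<alpha> * (1 - N):] + monom (- \<alpha> - N + \<alpha> * N) n"
  have "coeff q 0 = \<alpha> * (1 - N)" "coeff q n = - \<alpha> - N + \<alpha> * N"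
    using n by (auto simp: q_def coeff_pCons split: nat.splits)
  moreover have "N \<noteq> 1" using n by (simp add: N_def)
  ultimately have q: "q \<noteq> 0" using N by auto
  have w: "x ^ n = x\<^sup>2 * y" by (simp add: y_def m power2_eq_square)
  have Q: "to_fract q = a * (1 - c) + (- a - c + a * c) * (x\<^sup>2 * y)"
    by (simp add: q_def mon hom w a_def c_def)
  have nz: "x \<noteq> 0" "y \<noteq> 0" "c \<noteq> 0" "a * (1 - c) + (- a - c + a * c) * (x\<^sup>2 * y) \<noteq> 0"
    "(2 :: complex poly fract) \<noteq> 0"
  proof -
    show "x \<noteq> 0" by (simp add: x_def)
    then show "y \<noteq> 0" by (simp add: y_def)
    show "c \<noteq> 0" using N by (simp add: c_def)
    show "a * (1 - c) + (- a - c + a * c) * (x\<^sup>2 * y) \<noteq> 0"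
      using q by (simp flip: Q)
    show "(2 :: complex poly fract) \<noteq> 0" by (simp flip: two)
  qed
  have d1: "pderiv (monom 1 n - 1) = monom N (n - 1)"
    by (simp add: pderiv_diff pderiv_monom N_def)
  have d2: "pderiv (monom N (n - 1)) = monom (N * (N - 1)) m"
    using n by (simp add: pderiv_monom m_def N_def of_nat_diff mult.commute numeral_2_eq_2)
  have F: "to_fract (monom 1 n - 1) = x\<^sup>2 * y - 1"
    "to_fract (monom N (n - 1)) = c * (x * y)"
    "to_fract (monom (N * (N - 1)) m) = c * (c - 1) * y"
    by (simp_all add: mon hom w c_def y_def) (simp_all add: m)
  have num: "to_fract ([:(1 - 2 * \<alpha>) * (N - 1):]
        + monom (2 - 4 * \<alpha> - 4 * N + 6 * \<alpha> * N - 2 * \<alpha> * N ^ 2) n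
        + monom ((N - 1) * (1 - 2 * \<alpha> - 2 * N + 2 * \<alpha> * N)) (2 * n)) =
      (1 - 2 * a) * (c - 1) + (2 - 4 * a - 4 * c + 6 * a * c - 2 * a * c\<^sup>2) * (x\<^sup>2 * y)
      + (c - 1) * (1 - 2 * a - 2 * c + 2 * a * c) * (x\<^sup>2 * y)\<^sup>2"
  proof -
    have "x ^ (2 * n) = (x\<^sup>2 * y)\<^sup>2"
      by (simp only: flip: w) (simp add: power_mult mult.commute flip: power_mult)
    then show ?thesis
      by (simp add: mon hom w power2_eq_square[of N] power2_eq_square[of "to_fract [:N:]"] a_def c_def)
  qed
  have den: "to_fract (monom (2 * N) (n - 1) * q) =
      2 * c * (x * y) * (a * (1 - c) + (- a - c + a * c) * (x\<^sup>2 * y))"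
    by (simp add: mon hom c_def Q) (simp add: m y_def)
  show ?thesis
    unfolding chebyshev_halley_def Let_def d1 d2 F Fract_conv_to_fract num q_def[symmetric] den
    using chebyshev_halley_field_identity[OF nz] by (simp only: x_def a_def)
qed

section \<open>Basins of attraction and connectivity\<close>

definition attraction_basin ::
  "(complex option \<Rightarrow> complex option) \<Rightarrow> complex option \<Rightarrow> complex option set" where
  "attraction_basin g p = {x. limitin riemann_sphere (\<lambda>k. (g ^^ k) x) p sequentially}"

definition immediate_basin ::
  "(complex option \<Rightarrow> complex option) \<Rightarrow> complex option \<Rightarrow> complex option set" where
  "immediate_basin g p =
     connected_component_of_set (subtopology riemann_sphere (attraction_basin g p)) p"

definition infinitely_connected :: "complex option set \<Rightarrow> bool" where
  "infinitely_connected U \<longleftrightarrow>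
     openin riemann_sphere U \<and> connectedin riemann_sphere U \<and>
     infinite (connected_components_of (subtopology riemann_sphere (- U)))"

end

theory Submission
  imports Defs "HOL-Complex_Analysis.Conformal_Mappings"
begin

text \<open>
  Put \<open>\<delta> = 1 / ((n - 1) * \<alpha>)\<close> and \<open>z = 1 + \<delta> * t\<close>. In the coordinate \<open>t\<close> the map is
  asymptotic to \<open>(n - 1) / 2 * \<delta> * t ^ 3 / (t - 1)\<close> as \<open>\<delta> \<rightarrow> 0\<close>, uniformly
  for bounded \<open>t\<close> away from \<open>1\<close>. So for small \<open>\<delta>\<close> the disc \<open>\<bar>t\<bar> \<le> 1 / 2\<close> and the circle \<open>\<bar>t - 1\<bar> = 1 / 2\<close> are mapped into the former disc and
  lie in the immediate basin \<open>A\<close>, whereas \<open>\<bar>t - 1\<bar> < 1 / 2\<close> contains a pole and its image contains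
  the complement \<open>K\<close> of \<open>A\<close>. Inside that disc \<open>K\<close> is exactly the preimage of \<open>K\<close>, so the points of \<open>K\<close>
  that stay in the disc for \<open>k\<close> steps form a clopen subset \<open>Q k\<close> of \<open>K\<close>. Pulling back the fixed
  point \<open>\<infinity>\<close>, which is outside the disc, gives for each \<open>k\<close> a point of \<open>Q k\<close> outside \<open>Q (k + 1)\<close>, and these
  points lie in pairwise different components of \<open>K\<close>.
\<close>

section \<open>Basins on the sphere\<close>

lemma openin_riemann_sphere_image_Some [simp]: "openin riemann_sphere (Some ` V) \<longleftrightarrow> open V"
  by (simp add: riemann_sphere_def)

lemma closedin_riemann_sphere_image_Some [simp]:
  "closedin riemann_sphere (Some ` V) \<longleftrightarrow> compact V"
  by (auto simp: riemann_sphere_def compact_imp_closed)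

lemma continuous_map_Some_riemann_sphere: "continuous_map euclidean riemann_sphere Some"
  by (simp add: riemann_sphere_def continuous_map_Some)

lemma Hausdorff_riemann_sphere: "Hausdorff_space riemann_sphere"
  by (simp add: riemann_sphere_def Hausdorff_space_Alexandroff_compactification
      Hausdorff_space_euclidean locally_compact_space_euclidean)

lemma attraction_basin_iff: "f x \<in> attraction_basin f p \<longleftrightarrow> x \<in> attraction_basin f p"
proof -
  have "limitin riemann_sphere (\<lambda>k. (f ^^ k) (f x)) p sequentially \<longleftrightarrow>
      limitin riemann_sphere (\<lambda>k. (f ^^ (k + 1)) x) p sequentially"
    by (simp add: funpow_swap1)
  also have "\<dots> \<longleftrightarrow> limitin riemann_sphere (\<lambda>k. (f ^^ k) x) p sequentially"
    using limitin_sequentially_offset[of _ "\<lambda>k. (f ^^ k) x" p 1]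
      limitin_sequentially_offset_rev[of _ "\<lambda>k. (f ^^ k) x" 1 p] by blast
  finally show ?thesis by (simp add: attraction_basin_def)
qed

text \<open>\<open>Some\<close> embeds the plane into the sphere, so components of a set of finite
  points can be computed in the plane.\<close>

lemma immediate_basin_eq_image_Some:
  assumes "attraction_basin f (Some a) = Some ` B" "a \<in> B"
  shows "immediate_basin f (Some a) = Some ` connected_component_set B a"
proof -
  have "homeomorphic_map euclidean (subtopology riemann_sphere (range Some)) (Some :: complex \<Rightarrow> _)"
    using embedding_map_Some[of "euclidean :: complex topology"]
    by (simp add: riemann_sphere_def embedding_map_def)
  from homeomorphic_map_subtopologies[OF this, of B "Some ` B"]
  have "homeomorphic_map (top_of_set B) (subtopology riemann_sphere (range Some \<inter> Some ` B)) Some"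
    by (simp add: subtopology_subtopology Int_absorb1 image_mono)
  moreover have "range Some \<inter> Some ` B = Some ` B" by auto
  ultimately have "homeomorphic_map (top_of_set B) (subtopology riemann_sphere (Some ` B)) Some"
    by simp
  from homeomorphic_map_connected_component_of[OF this, of a] assms
  have "immediate_basin f (Some a) = Some ` connected_component_of_set (top_of_set B) a"
    by (simp add: immediate_basin_def)
  also have "connected_component_of_set (top_of_set B) a = connected_component_set B a"
    by (auto simp: connected_component_of_def connected_component_def connectedin_subtopology)
  finally show ?thesis .
qed

section \<open>Basins in the plane when infinity is fixed\<close>

locale planar_basin =
  fixes f :: "complex option \<Rightarrow> complex option" and a :: complex and N :: "complex set"
  assumes cont: "continuous_map euclidean riemann_sphere (\<lambda>z. f (Some z))"
    and infinity: "f None = None" and fixed: "f (Some a) = Some a"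
    and open_N: "open N" and a_N: "a \<in> N"
    and N_basin: "Some ` N \<subseteq> attraction_basin f (Some a)"
begin

definition B :: "complex set" where "B = {z. Some z \<in> attraction_basin f (Some a)}"

definition A :: "complex set" where "A = connected_component_set B a"

lemma None_notin_basin: "None \<notin> attraction_basin f (Some a)"
proof
  assume "None \<in> attraction_basin f (Some a)"
  then have "limitin riemann_sphere (\<lambda>k. (f ^^ k) None) (Some a) sequentially"
    by (simp add: attraction_basin_def)
  moreover have "openin riemann_sphere (Some ` UNIV)" by (simp only: openin_riemann_sphere_image_Some open_UNIV)
  ultimately have "\<forall>\<^sub>F k in sequentially. (f ^^ k) None \<in> range Some"
    unfolding limitin_def by (metis rangeI)
  moreover have "(f ^^ k) None = None" for k
    by (induction k) (simp_all add: infinity)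
  ultimately show False by auto
qed

lemma basin_eq: "attraction_basin f (Some a) = Some ` B"
proof -
  have "x \<in> Some ` B" if "x \<in> attraction_basin f (Some a)" for x
    using that None_notin_basin by (cases x) (auto simp: B_def)
  then show ?thesis by (auto simp: B_def)
qed

lemma a_B: "a \<in> B"
  using N_basin a_N by (auto simp: B_def)

lemma basin_step: "f (Some z) \<in> Some ` B \<longleftrightarrow> z \<in> B"
  using attraction_basin_iff[of f "Some z" "Some a"] by (simp add: basin_eq inj_image_mem_iff)

lemma open_vimage: 
  assumes "openin riemann_sphere U"
  shows "open {z. f (Some z) \<in> U}"
  using openin_continuous_map_preimage[OF cont assms] by simp

text \<open>An orbit converges to \<open>a\<close> exactly when it enters \<open>N\<close> at some
  time, so \<open>B\<close> is a union of preimages of \<open>N\<close> under the iterates.\<close>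

lemma open_B: "open B"
proof -
  define E where "E k = {z. (f ^^ k) (Some z) \<in> Some ` N}" for k
  have "open (E k)" for k
  proof (induction k)
    case 0
    then show ?case using open_N by (simp add: E_def inj_image_mem_iff)
  next
    case (Suc k)
    \<comment> \<open>Infinity is fixed and never reaches \<open>N\<close>. Hence
      \<open>E (Suc k)\<close> is a one-step preimage of the planar set \<open>E k\<close>, and
      continuity at finite points gives openness.\<close>
    have *: "x \<in> range Some" if "(f ^^ k) x \<in> Some ` N" for x
    proof (rule ccontr)
      assume "x \<notin> range Some"
      then have "x = None" by (cases x) auto
      moreover have "(f ^^ j) None = None" for j
        by (induction j) (simp_all add: infinity)
      ultimately show False using that by auto
    qed
    have "E (Suc k) = {z. f (Some z) \<in> Some ` E k}"
    proof (intro set_eqI)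
      fix z show "z \<in> E (Suc k) \<longleftrightarrow> z \<in> {z. f (Some z) \<in> Some ` E k}"
        using *[of "f (Some z)"] by (auto simp: E_def funpow_swap1)
    qed
    then show ?case using Suc open_vimage[of "Some ` E k"] by simp
  qed
  moreover have "B = (\<Union>k. E k)"
  proof
    show "B \<subseteq> (\<Union>k. E k)"
    proof
      fix z assume "z \<in> B"
      then have "limitin riemann_sphere (\<lambda>k. (f ^^ k) (Some z)) (Some a) sequentially"
        by (simp add: B_def attraction_basin_def)
      then have "\<forall>\<^sub>F k in sequentially. (f ^^ k) (Some z) \<in> Some ` N"
        using open_N a_N by (simp add: limitin_def)
      then show "z \<in> (\<Union>k. E k)" 
        unfolding E_def eventually_sequentially by blast
    qed
    have "x \<in> attraction_basin f (Some a)" if "(f ^^ k) x \<in> Some ` N" for x k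
      using that
    proof (induction k arbitrary: x)
      case 0
      then show ?case using N_basin by auto
    next
      case (Suc k)
      then show ?case using attraction_basin_iff by (metis funpow_Suc_right comp_apply)
    qed
    then show "(\<Union>k. E k) \<subseteq> B" by (auto simp: E_def B_def)
  qed
  ultimately show ?thesis by auto
qed

lemma immediate_basin_eq: "immediate_basin f (Some a) = Some ` A"
  by (simp add: A_def immediate_basin_eq_image_Some[OF basin_eq a_B])

lemma open_A: "open A"
  by (simp add: A_def open_B open_connected_component)

lemma connected_A: "connected A"
  by (simp add: A_def)

lemma a_A: "a \<in> A" and A_subset_B: "A \<subseteq> B"
  by (simp_all add: A_def a_B connected_component_subset)

lemma image_connected_subset_A:
  assumes "connected C" "C \<subseteq> B" "z \<in> C" "f (Some z) \<in> Some ` A"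
  shows "(\<lambda>z. f (Some z)) ` C \<subseteq> Some ` A"
proof -
  have "connectedin riemann_sphere ((\<lambda>z. f (Some z)) ` C)"
    using assms(1) connectedin_continuous_map_image[OF cont] by simp
  moreover have "(\<lambda>z. f (Some z)) ` C \<subseteq> attraction_basin f (Some a)"
    using assms(2) basin_step by (auto simp: basin_eq)
  ultimately have conn: "connectedin (subtopology riemann_sphere (attraction_basin f (Some a))) ((\<lambda>z. f (Some z)) ` C)"
    by (simp add: connectedin_subtopology)
  define p where "p = f (Some z)"
  have p: "connected_component_of (subtopology riemann_sphere (attraction_basin f (Some a))) (Some a) p"
    using assms(4) unfolding immediate_basin_eq[symmetric] immediate_basin_def p_def by simp
  have "(\<lambda>z. f (Some z)) ` C \<subseteq> connected_component_of_set (subtopology riemann_sphere (attraction_basin f (Some a))) p"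
    using conn assms(3) by (intro connected_component_of_maximal) (auto simp: p_def)
  also have "\<dots> = Some ` A"
    using p unfolding immediate_basin_eq[symmetric] immediate_basin_def
    by (metis connected_component_of_equiv)
  finally show ?thesis .
qed

lemma connected_subset_A: 
  assumes "connected C" "C \<subseteq> B" "z \<in> C" "z \<in> A"
  shows "C \<subseteq> A"
  using assms connected_component_maximal[of z C B] unfolding A_def
  by (metis connected_component_eq)

end

section \<open>A disc bounded by a circle in the immediate basin\<close>

locale pole_disc = planar_basin +
  fixes U :: "complex set" and c :: complex and r :: real
  assumes U: "connected U" "a \<in> U" "Some ` U \<subseteq> attraction_basin f (Some a)"
    and sphere_U: "sphere c r \<subseteq> U"
    and open_map: "\<And>C. open C \<Longrightarrow> C \<subseteq> ball c r \<Longrightarrow> None \<notin> (\<lambda>z. f (Some z)) ` C \<Longrightarrow>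
      open {w. Some w \<in> (\<lambda>z. f (Some z)) ` C}"
    and ne_a: "\<And>z. z \<in> ball c r \<Longrightarrow> f (Some z) \<noteq> Some a"
    and covers: "\<And>y. y \<notin> Some ` U \<Longrightarrow> \<exists>z\<in>ball c r. f (Some z) = y"
begin

text \<open>\<open>U\<close> joins the circle to \<open>a\<close> inside the basin. As a result no
  component of the basin other than \<open>A\<close> can meet the circle.\<close>

lemma U_subset_A: "U \<subseteq> A"
proof -
  have "U \<subseteq> B" using U(3) by (auto simp: B_def)
  then show ?thesis using connected_subset_A[of U a] U a_A by blast
qed

text \<open>
  A component \<open>C\<close> of the basin inside the disc that is mapped into \<^term>\<open>A\<close> would be mapped onto
  \<^term>\<open>A\<close>, because its image is open and closed in \<^term>\<open>A\<close>; but the disc omits the value \<^term>\<open>a\<close>.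
\<close>

lemma disc_preimage_A:
  assumes z: "z \<in> ball c r" and fz: "f (Some z) \<in> Some ` A"
  shows "z \<in> A"
proof (rule ccontr)
  assume zA: "z \<notin> A"
  let ?g = "\<lambda>z. f (Some z)"
  have zB: "z \<in> B" using fz A_subset_B basin_step by blast
  define C where "C = connected_component_set B z"
  have C: "open C" "connected C" "C \<subseteq> B" "z \<in> C"
    using zB by (auto simp: C_def open_B open_connected_component connected_component_subset)
  have disj: "C \<inter> A = {}"
    using connected_subset_A[of C] C zA by blast
  have ball: "C \<subseteq> ball c r"
  proof (rule ccontr)
    assume "\<not> C \<subseteq> ball c r"
    then have "C \<inter> frontier (ball c r) \<noteq> {}"
      using C(2,4) z by (intro connected_Int_frontier) auto
    moreover have "r > 0" using z zero_le_dist[of c z] by (simp del: zero_le_dist)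
    ultimately have "C \<inter> sphere c r \<noteq> {}" by simp
    then show False using sphere_U U_subset_A disj by blast
  qed
  have img: "?g ` C \<subseteq> Some ` A"
    using image_connected_subset_A[OF C(2,3,4) fz] .
  define T where "T = {w. Some w \<in> ?g ` C}"
  have "open T"
    unfolding T_def using img by (intro open_map C ball) auto
  have TA: "T \<subseteq> A" using img by (auto simp: T_def)
  obtain w where "f (Some z) = Some w" using fz by blast
  then have "w \<in> T" using C(4) by (auto simp: T_def intro!: image_eqI[of _ _ z])
  \<comment> \<open>Closedness comes from the compact closure of \<open>C\<close>, whose image is
    closed on the sphere. A point of the closure mapped into \<open>A\<close> is in the basin by
    invariance, and so belongs to the component \<open>C\<close>; closing \<open>C\<close> therefore
    adds no value in \<open>A\<close>.\<close>
  define T' where "T' = {w. Some w \<in> ?g ` closure C}"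
  have "compact (closure C)"
    using ball bounded_ball bounded_subset by auto
  then have "compactin riemann_sphere (?g ` closure C)"
    using image_compactin[OF _ cont] by simp
  then have "closedin riemann_sphere (?g ` closure C)"
    using Hausdorff_riemann_sphere compactin_imp_closedin by blast
  then have "closed T'"
    using closedin_continuous_map_preimage[OF continuous_map_Some_riemann_sphere] unfolding T'_def
    by simp
  have "T = A \<inter> T'"
  proof
    show "T \<subseteq> A \<inter> T'" using TA closure_subset by (auto simp: T_def T'_def)
    show "A \<inter> T' \<subseteq> T"
    proof
      fix w assume w: "w \<in> A \<inter> T'"
      then obtain y where y: "y \<in> closure C" "?g y = Some w" by (auto simp: T'_def)
      then have "y \<in> B" using w A_subset_B basin_step by (metis IntD1 imageI subsetD)
      have "connected (insert y C)"
        using y(1) closure_subset by (intro connected_intermediate_closure[OF C(2)]) auto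
      then have "insert y C \<subseteq> C"
        unfolding C_def using C(4) \<open>y \<in> B\<close> C(3) by (intro connected_component_maximal) (auto simp: C_def)
      then show "w \<in> T" using y(2) by (auto simp: T_def intro!: image_eqI[of _ _ y])
    qed
  qed
  then have "closedin (top_of_set A) T" using \<open>closed T'\<close> closedin_closed_Int by blast
  moreover have "openin (top_of_set A) T"
    using \<open>open T\<close> TA by (simp add: open_subset)
  ultimately have "T = A"
    using connected_A \<open>w \<in> T\<close> unfolding connected_clopen by blast
  then show False using a_A ne_a ball by (force simp: T_def)
qed

lemma image_A: "f ` Some ` A \<subseteq> Some ` A"
  using image_connected_subset_A[OF connected_A A_subset_B a_A] a_A fixed by (auto simp: image_image)

section \<open>Clopen pieces of the complement of the immediate basin\<close>

definition K :: "complex option set" where "K = - (Some ` A)"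

definition D :: "complex option set" where "D = Some ` ball c r"

lemma None_K: "None \<in> K" by (auto simp: K_def)

text \<open>The boundary circle lies in \<open>A\<close>, so the open and the closed disc cut out
  the same part of \<open>K\<close>. This makes that part both open and closed in
  \<open>K\<close>.\<close>

lemma K_Int_D: "K \<inter> D = K \<inter> Some ` cball c r"
proof -
  have "cball c r = ball c r \<union> sphere c r" by auto
  then show ?thesis using sphere_U U_subset_A by (auto simp: K_def D_def)
qed

text \<open>\<open>disc_preimage_A\<close> keeps the image in \<open>K\<close>, and the disc omits
  infinity, the one point where \<open>cont\<close> gives no continuity.\<close>

lemma continuous_map_K: "continuous_map (subtopology riemann_sphere (K \<inter> D)) (subtopology riemann_sphere K) f"
proof -
  have "continuous_map (subtopology riemann_sphere (K \<inter> D)) riemann_sphere f"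
  proof (rule continuous_map_from_subtopology_mono)
    show "continuous_map (subtopology riemann_sphere (range Some)) riemann_sphere f"
      unfolding continuous_map_def
    proof (intro conjI allI impI)
      fix V assume V: "openin riemann_sphere V"
      have "{x \<in> topspace (subtopology riemann_sphere (range Some)). f x \<in> V}
         = Some ` {z. f (Some z) \<in> V}" by auto
      moreover have "openin riemann_sphere (Some ` {z. f (Some z) \<in> V})"
        using open_vimage[OF V] by simp
      ultimately show "openin (subtopology riemann_sphere (range Some))
         {x \<in> topspace (subtopology riemann_sphere (range Some)). f x \<in> V}"
        by (auto intro!: subset_openin_subtopology)
    qed auto
  qed (auto simp: D_def)
  moreover have "f x \<in> K" if "x \<in> K \<inter> D" for x
    using that disc_preimage_A by (auto simp: K_def D_def)
  ultimately show ?thesis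
    by (simp add: continuous_map_in_subtopology image_subset_iff)
qed

text \<open>A point outside \<open>A\<close> is outside \<open>U\<close>, so \<open>covers\<close>
  supplies a preimage in the disc; forward invariance of \<open>A\<close> puts that preimage in
  \<open>K\<close>.\<close>

lemma preimage_K:
  assumes "y \<in> K"
  shows "\<exists>x\<in>K \<inter> D. f x = y"
proof -
  have "y \<notin> Some ` U" using assms U_subset_A by (auto simp: K_def)
  then obtain z where "z \<in> ball c r" "f (Some z) = y" using covers by blast
  then show ?thesis
    using assms image_A by (intro bexI[of _ "Some z"]) (auto simp: K_def D_def)
qed

text \<open>Membership in \<open>Q k\<close> asks that the orbit lie in the disc at the times before
  \<open>k\<close>, whereas at time \<open>k\<close> it need only lie in \<open>K\<close>.\<close>

fun Q :: "nat \<Rightarrow> complex option set" where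
  "Q 0 = K"
| "Q (Suc k) = {x \<in> K \<inter> D. f x \<in> Q k}"

lemma clopen_Q:
  "openin (subtopology riemann_sphere K) (Q k) \<and> closedin (subtopology riemann_sphere K) (Q k)"
proof (induction k)
  case 0
  then show ?case using openin_topspace[of "subtopology riemann_sphere K"] 
    closedin_topspace[of "subtopology riemann_sphere K"] by simp
next
  case (Suc k)
  let ?X = "subtopology riemann_sphere K"
  have sub: "subtopology ?X (K \<inter> D) = subtopology riemann_sphere (K \<inter> D)"
    by (simp add: subtopology_subtopology)
  have eq: "Q (Suc k) = {x \<in> topspace (subtopology riemann_sphere (K \<inter> D)). f x \<in> Q k}"
    by simp
  have "openin riemann_sphere D" by (simp add: D_def)
  then have o: "openin ?X (K \<inter> D)" by (rule openin_subtopology_Int2)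
  have "closedin riemann_sphere (Some ` cball c r)" by simp
  then have cl: "closedin ?X (K \<inter> D)" unfolding K_Int_D by (rule closedin_subtopology_Int_closed)
  have "openin (subtopology ?X (K \<inter> D)) (Q (Suc k))"
    unfolding eq sub using continuous_map_K Suc by (intro openin_continuous_map_preimage) auto
  moreover have "closedin (subtopology ?X (K \<inter> D)) (Q (Suc k))"
    unfolding eq sub using continuous_map_K Suc by (intro closedin_continuous_map_preimage) auto
  ultimately show ?case using o cl openin_trans_full closedin_trans_full by blast
qed

lemma infinite_components: "infinite (connected_components_of (subtopology riemann_sphere K))"
proof -
  let ?X = "subtopology riemann_sphere K"
  \<comment> \<open>\<open>g\<close> chooses a preimage in the disc for every point of
    \<open>K\<close>, pointwise and without continuity.\<close>
  obtain g where g: "\<And>y. y \<in> K \<Longrightarrow> g y \<in> K \<inter> D \<and> f (g y) = y"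
    using preimage_K by metis
  define x where "x k = (g ^^ k) None" for k
  have x_K: "x k \<in> K" for k
    by (induction k) (use g None_K in \<open>auto simp: x_def\<close>)
  \<comment> \<open>The starting point, infinity, lies in \<open>K\<close> but not in the disc, so
    it belongs to \<open>Q 0\<close> alone; each application of \<open>g\<close> adds exactly one
    stage.\<close>
  have x_Q: "x k \<in> Q j \<longleftrightarrow> j \<le> k" for k j
  proof (induction k arbitrary: j)
    case 0
    then show ?case by (cases j) (auto simp: x_def None_K D_def)
  next
    case (Suc k)
    have "x (Suc k) = g (x k)" by (simp add: x_def)
    then show ?case using Suc g[OF x_K[of k]] by (cases j) auto
  qed
  define F where "F k = connected_component_of_set ?X (x k)" for k
  \<comment> \<open>A component lies inside or outside the clopen set \<open>Q k\<close>. Since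
    \<open>x k\<close> is in \<open>Q k\<close>, a shared component puts \<open>x j\<close> there
    too, which forces \<open>k \<le> j\<close>; exchanging the roles gives injectivity.\<close>
  have le: "k \<le> j" if "F j = F k" for j k
  proof -
    have "x i \<in> F i" for i
      using x_K by (simp add: F_def connected_component_of_refl)
    then have "x j \<in> F j" "x k \<in> F j" using that by blast+
    moreover have "F j \<subseteq> Q k \<or> disjnt (F j) (Q k)"
      using clopen_Q by (intro connectedin_clopen_cases[of ?X]) (auto simp: F_def connectedin_connected_component_of)
    ultimately show ?thesis using x_Q by (metis disjnt_iff order_refl subsetD)
  qed
  then have "inj F" by (intro injI) (metis order_antisym)
  moreover have "range F \<subseteq> connected_components_of ?X"
    using x_K by (auto simp: F_def connected_component_in_connected_components_of)
  ultimately show ?thesis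
    using infinite_super range_inj_infinite by blast
qed

theorem infinitely_connected_immediate_basin:
  "infinitely_connected (immediate_basin f (Some a))"
proof -
  have "connectedin riemann_sphere (Some ` A)"
    using connected_A connectedin_continuous_map_image[OF continuous_map_Some_riemann_sphere] by simp
  then show ?thesis
    using infinite_components
    by (simp add: infinitely_connected_def immediate_basin_eq open_A K_def)
qed

end

section \<open>Rational maps\<close>

lemma coprime_poly_roots:
  fixes p q :: "complex poly"
  assumes "coprime p q" "poly q z = 0"
  shows "poly p z \<noteq> 0"
proof
  assume "poly p z = 0"
  then have "[:- z, 1:] dvd p" "[:- z, 1:] dvd q"
    using assms(2) by (simp_all add: poly_eq_0_iff_dvd)
  then have "is_unit [:- z, 1:]"
    using assms(1) coprime_common_divisor by blast
  then show False by (simp add: is_unit_iff_degree)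
qed

text \<open>Coprimality excludes a common zero of \<open>p\<close> and \<open>q\<close>. The two
  cases of the proof are the two kinds of open sets of the compactification.\<close>

lemma continuous_map_rational_map:
  "continuous_map euclidean riemann_sphere (\<lambda>z. rational_map r (Some z))"
proof -
  obtain p q where pq: "quot_of_fract r = (p, q)" by force
  have cop: "poly p z \<noteq> 0" if "poly q z = 0" for z
    using coprime_poly_roots[OF _ that] coprime_quot_of_fract[of r] pq by simp
  have r: "rational_map r (Some z) = (if poly q z = 0 then None else Some (poly p z / poly q z))" for z
    by (simp add: rational_map_def pq)
  have nz: "open {z. poly q z \<noteq> 0}"
    by (intro open_Collect_neq continuous_intros)
  have "open {z. rational_map r (Some z) \<in> V}" if "openin riemann_sphere V" for V
    using that unfolding riemann_sphere_def openin_Alexandroff_compactification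
  proof (elim disjE exE conjE)
    fix W :: "complex set" assume W: "openin euclidean W" "V = Some ` W"
    have "open ({z. poly q z \<noteq> 0} \<inter> (\<lambda>z. poly p z / poly q z) -` W)"
      using W nz by (intro continuous_open_preimage continuous_intros) auto
    also have "{z. poly q z \<noteq> 0} \<inter> (\<lambda>z. poly p z / poly q z) -` W = {z. rational_map r (Some z) \<in> V}"
      by (auto simp: r W)
    finally show ?thesis .
  next
    fix C :: "complex set"
    assume C: "compactin euclidean C" "V = insert None (Some ` (topspace euclidean - C))"
    then obtain M where M: "\<And>w. w \<in> C \<Longrightarrow> norm w \<le> M"
      using compact_imp_bounded bounded_iff by (metis compactin_euclidean_iff)
    \<comment> \<open>\<open>S\<close> is closed and free of poles, because a zero of
      \<open>q\<close> in \<open>S\<close> would also be a zero of \<open>p\<close>. It contains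
      every point mapped into \<open>C\<close>, so the preimage of \<open>C\<close> can be formed
      inside \<open>S\<close>, where the quotient is continuous.\<close>
    define S where "S = {z. norm (poly p z) \<le> M * norm (poly q z)}"
    have "closed S"
      unfolding S_def by (intro closed_Collect_le continuous_intros)
    have q: "poly q z \<noteq> 0" if "z \<in> S" for z
      using that cop by (auto simp: S_def)
    have "closed (S \<inter> (\<lambda>z. poly p z / poly q z) -` C)"
      using q \<open>closed S\<close> C by (intro continuous_closed_preimage continuous_intros) (auto simp: compact_imp_closed)
    also have "S \<inter> (\<lambda>z. poly p z / poly q z) -` C = - {z. rational_map r (Some z) \<in> V}"
    proof -
      have "z \<in> S" if "poly q z \<noteq> 0" "poly p z / poly q z \<in> C" for z
        using M[OF that(2)] that(1) by (simp add: S_def norm_divide field_simps)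
      then show ?thesis using q by (auto simp: r C)
    qed
    finally show ?thesis by (simp add: closed_def)
  qed
  then show ?thesis by (simp add: continuous_map_def)
qed

lemma quot_of_fract_Fract_cross:
  fixes P Q :: "complex poly"
  assumes "Q \<noteq> 0" "quot_of_fract (Fract P Q) = (p, q)"
  shows "p * Q = P * q" "coprime p q" "q \<noteq> 0"
proof -
  have "Fract p q = Fract P Q" using assms by (metis Fract_quot_of_fract fst_conv snd_conv)
  moreover show q: "q \<noteq> 0" using assms snd_quot_of_fract_nonzero by (metis snd_conv)
  ultimately show "p * Q = P * q" using assms by (simp add: eq_fract)
  show "coprime p q" using coprime_quot_of_fract[of "Fract P Q"] assms by simp
qed

text \<open>Cross multiplication with the reduced fraction shows that both denominators vanish
  together at \<open>z\<close>; the first hypothesis excludes a zero of \<open>Q\<close> that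
  cancels.\<close>

lemma rational_map_Fract_Some:
  fixes P Q :: "complex poly"
  assumes "poly Q z = 0 \<Longrightarrow> poly P z \<noteq> 0" "Q \<noteq> 0"
  shows "rational_map (Fract P Q) (Some z) =
    (if poly Q z = 0 then None else Some (poly P z / poly Q z))"
proof -
  obtain p q where pq: "quot_of_fract (Fract P Q) = (p, q)" by force
  note cross = quot_of_fract_Fract_cross[OF assms(2) pq]
  have eq: "poly p z * poly Q z = poly P z * poly q z"
    using cross(1) by (metis poly_mult)
  have "poly q z = 0 \<longleftrightarrow> poly Q z = 0"
    using eq coprime_poly_roots[OF cross(2)] assms(1) by auto
  then show ?thesis using eq by (auto simp: rational_map_def pq frac_eq_eq)
qed

text \<open>Cancelling common factors preserves the difference of the two degrees, which decides
  whether infinity is fixed.\<close>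

lemma rational_map_Fract_None:
  fixes P Q :: "complex poly"
  assumes "degree P > degree Q" "Q \<noteq> 0"
  shows "rational_map (Fract P Q) None = None"
proof -
  obtain p q where pq: "quot_of_fract (Fract P Q) = (p, q)" by force
  note cross = quot_of_fract_Fract_cross[OF assms(2) pq]
  have "P \<noteq> 0" using assms by auto
  then have "p \<noteq> 0" using cross assms by auto
  have "degree p + degree Q = degree P + degree q"
    using cross(1,3) \<open>p \<noteq> 0\<close> \<open>P \<noteq> 0\<close> assms(2) by (metis degree_mult_eq)
  then have "degree p > degree q" using assms by linarith
  then show ?thesis by (simp add: rational_map_def pq)
qed

section \<open>From estimates in a scaled coordinate to infinite connectivity\<close>

lemma ball_subset_holomorphic_image:
  assumes "h holomorphic_on ball c r" "continuous_on (cball c r) h" "\<not> h constant_on ball c r"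
    and "\<And>z. z \<in> sphere c r \<Longrightarrow> s \<le> norm (h z - h a)" and "a \<in> ball c r" "s > 0"
  shows "ball (h a) s \<subseteq> h ` ball c r"
proof (rule ball_subset_open_map_image)
  have "r > 0" using assms(5) by (metis ball_empty empty_iff not_le)
  then show "continuous_on (closure (ball c r)) h" "\<And>z. z \<in> frontier (ball c r) \<Longrightarrow> s \<le> norm (h z - h a)"
    using assms by auto
  show "open (h ` interior (ball c r))"
    using assms by (intro open_mapping_thm[of h "ball c r"]) auto
qed (use assms in auto)

text \<open>In the coordinate \<open>t\<close> the map is \<open>p / q\<close>. The cubic bound
  makes the disc about \<open>0\<close> attracted to the root and sends the circle about
  \<open>1\<close> into that disc; the zero of \<open>q\<close> inside the circle is the pole that
  \<open>pole_disc\<close> works with.\<close>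

lemma infinitely_connected_immediate_basin_scaled:
  fixes f :: "complex option \<Rightarrow> complex option" and p q :: "complex \<Rightarrow> complex" and \<delta> :: complex
  assumes cont: "continuous_map euclidean riemann_sphere (\<lambda>z. f (Some z))"
    and infinity: "f None = None"
    and \<delta>: "\<delta> \<noteq> 0"
    and f: "\<And>t. norm t \<le> 3 / 2 \<Longrightarrow>
      f (Some (1 + \<delta> * t)) = (if q t = 0 then None else Some (1 + \<delta> * (p t / q t)))"
    and hol: "p holomorphic_on UNIV" "q holomorphic_on UNIV"
    and p_0: "\<And>t. norm t \<le> 3 / 2 \<Longrightarrow> t \<noteq> 0 \<Longrightarrow> p t \<noteq> 0"
    and est: "\<And>t. t \<in> cball 0 (1 / 2) \<union> sphere 1 (1 / 2) \<Longrightarrow>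
      q t \<noteq> 0 \<and> norm (p t) \<le> norm t ^ 3 / 8 * norm (q t)"
    and zero: "\<exists>t\<in>ball 1 (1 / 2). q t = 0" and nonzero: "\<exists>t\<in>ball 1 (1 / 2). q t \<noteq> 0"
  shows "infinitely_connected (immediate_basin f (Some 1))"
proof -
  define g where "g t = p t / q t" for t
  define U\<^sub>0 :: "complex set" where "U\<^sub>0 = cball 0 (1 / 2) \<union> sphere 1 (1 / 2)"
  have bound: "norm t \<le> 3 / 2" if "t \<in> cball 1 (1 / 2)" for t :: complex
    using that norm_triangle_ineq[of "t - 1" 1] by (simp add: dist_norm norm_minus_commute)
  have bound0: "norm t \<le> 3 / 2" if "t \<in> U\<^sub>0" for t :: complex
    using that bound[of t] by (auto simp: U\<^sub>0_def)
  have f_g: "f (Some (1 + \<delta> * t)) = Some (1 + \<delta> * g t)" if "t \<in> U\<^sub>0" for t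
    using f[OF bound0[OF that]] est that by (simp add: g_def U\<^sub>0_def)
  have g: "norm (g t) \<le> norm t ^ 3 / 8" if "t \<in> U\<^sub>0" for t
    using est[of t] that by (simp add: g_def norm_divide U\<^sub>0_def divide_le_eq)
  have g_half: "norm (g t) \<le> 1 / 2 * norm t" if "norm t \<le> 1 / 2" for t
  proof -
    have "norm t ^ 3 = norm t ^ 2 * norm t" by (simp add: power3_eq_cube power2_eq_square)
    also have "\<dots> \<le> 1 * norm t"
      using that by (intro mult_right_mono power_le_one) auto
    finally have "norm t ^ 3 \<le> norm t" by simp
    moreover have "norm (g t) \<le> norm t ^ 3 / 8" using g[of t] that by (simp add: U\<^sub>0_def)
    ultimately show ?thesis using norm_ge_zero[of t] by linarith
  qed
  \<comment> \<open>On \<open>U\<^sub>0\<close> the modulus of \<open>t\<close> is at most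
    \<open>3 / 2\<close>, and \<open>(3 / 2) ^ 3 / 8 = 27 / 64\<close> is below
    \<open>1 / 2\<close>. So one step carries the circle into the attracted disc.\<close>
  have g_lt: "norm (g t) < 1 / 2" if "t \<in> U\<^sub>0" for t
  proof -
    have "norm t ^ 3 \<le> (3 / 2) ^ 3" using bound0[OF that] by (intro power_mono) auto
    then show ?thesis using g[OF that] by (simp add: power3_eq_cube)
  qed
  have basin: "Some (1 + \<delta> * t) \<in> attraction_basin f (Some 1)" if "norm t \<le> 1 / 2" for t
  proof -
    have le: "norm ((g ^^ k) t) \<le> (1 / 2) ^ k * norm t" for k
    proof (induction k)
      case (Suc k)
      have "(1 / 2) ^ k * norm t \<le> 1 * norm t" by (intro mult_right_mono power_le_one) auto
      then have "norm ((g ^^ k) t) \<le> 1 / 2" using Suc that by linarith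
      then show ?case using g_half[of "(g ^^ k) t"] Suc by (simp add: mult_ac)
    qed simp
    have in_U: "(g ^^ k) t \<in> U\<^sub>0" for k
    proof -
      have "(1 / 2) ^ k * norm t \<le> 1 * norm t" by (intro mult_right_mono power_le_one) auto
      then show ?thesis using le[of k] that by (simp add: U\<^sub>0_def)
    qed
    have iter: "(f ^^ k) (Some (1 + \<delta> * t)) = Some (1 + \<delta> * (g ^^ k) t)" for k
      by (induction k) (simp_all add: f_g in_U)
    have "(\<lambda>k. (1 / 2) ^ k * norm t) \<longlonglongrightarrow> 0"
      by (intro tendsto_mult_left_zero LIMSEQ_power_zero) simp
    then have "(\<lambda>k. (g ^^ k) t) \<longlonglongrightarrow> 0"
      by (rule Lim_null_comparison[rotated]) (use le in auto)
    then have "(\<lambda>k. 1 + \<delta> * (g ^^ k) t) \<longlonglongrightarrow> 1 + \<delta> * 0"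
      by (intro tendsto_intros)
    then have "limitin euclidean (\<lambda>k. 1 + \<delta> * (g ^^ k) t) 1 sequentially" by simp
    from continuous_map_limit[OF continuous_map_Some_riemann_sphere this]
    show ?thesis by (simp add: attraction_basin_def iter o_def)
  qed
  have ball_scale: "(\<lambda>t. 1 + \<delta> * t) ` ball x e = ball (1 + \<delta> * x) (norm \<delta> * e)" for x e
  proof (intro equalityI subsetI)
    fix z assume "z \<in> ball (1 + \<delta> * x) (norm \<delta> * e)"
    then have "norm (\<delta> * (x - (z - 1) / \<delta>)) < norm \<delta> * e"
      using \<delta> by (simp add: dist_norm algebra_simps)
    then have "(z - 1) / \<delta> \<in> ball x e" using \<delta> by (simp add: norm_mult dist_norm)
    then show "z \<in> (\<lambda>t. 1 + \<delta> * t) ` ball x e" using \<delta> by (intro image_eqI) auto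
  next
    fix z assume "z \<in> (\<lambda>t. 1 + \<delta> * t) ` ball x e"
    then obtain t where t: "z = 1 + \<delta> * t" "t \<in> ball x e" by (rule imageE)
    have "1 + \<delta> * x - z = \<delta> * (x - t)" by (simp add: t(1) algebra_simps)
    then show "z \<in> ball (1 + \<delta> * x) (norm \<delta> * e)"
      using t(2) \<delta> by (simp add: dist_norm norm_mult)
  qed
  have fixed: "f (Some 1) = Some 1"
  proof -
    have "0 \<in> U\<^sub>0" by (simp add: U\<^sub>0_def)
    then show ?thesis using f_g[of 0] g[of 0] by simp
  qed
  define U where "U = (\<lambda>t. 1 + \<delta> * t) ` U\<^sub>0"
  \<comment> \<open>The reciprocal of \<open>g\<close> turns poles into zeros and is holomorphic on
    the closed disc about \<open>1\<close>, where \<open>p\<close> has no zero. There the map is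
    \<open>1 + \<delta> / h t\<close>, which never equals \<open>1\<close>.\<close>
  define h where "h t = q t / p t" for t
  have not_0: "(0::complex) \<notin> cball 1 (1 / 2)" by simp
  have p_nz: "p t \<noteq> 0" if "t \<in> cball 1 (1 / 2)" for t
    using p_0[OF bound[OF that]] not_0 that by metis
  have h_hol: "h holomorphic_on cball 1 (1 / 2)"
    unfolding h_def using hol p_nz by (intro holomorphic_intros) (auto intro: holomorphic_on_subset)
  have h_hol': "h holomorphic_on ball 1 (1 / 2)"
    using h_hol by (rule holomorphic_on_subset) auto
  have h_cont: "continuous_on (cball 1 (1 / 2)) h"
    using h_hol by (rule holomorphic_on_imp_continuous_on)
  obtain z0 z1 where z01: "z0 \<in> ball 1 (1 / 2)" "q z0 = 0" "z1 \<in> ball 1 (1 / 2)" "q z1 \<noteq> 0"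
    using zero nonzero by blast
  have "h z0 = 0" "h z1 \<noteq> 0" using z01 p_nz[of z1] by (auto simp: h_def)
  then have nonconst: "\<not> h constant_on ball 1 (1 / 2)"
    using z01 unfolding constant_on_def by metis
  \<comment> \<open>On the circle \<open>g\<close> is below \<open>1 / 2\<close> in modulus, so
    \<open>h\<close> exceeds \<open>2\<close> there while vanishing at \<open>z0\<close>. Hence
    \<open>h\<close> takes every value of modulus below \<open>2\<close>: the map attains infinity
    and every \<open>1 + \<delta> * s\<close> with \<open>norm s > 1 / 2\<close>.\<close>
  have "ball (h z0) 2 \<subseteq> h ` ball 1 (1 / 2)"
  proof (rule ball_subset_holomorphic_image[OF h_hol' h_cont nonconst])
    fix t :: complex assume t: "t \<in> sphere 1 (1 / 2)"
    then have "norm (g t) < 1 / 2" "q t \<noteq> 0" "p t \<noteq> 0"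
      using g_lt[of t] est[of t] p_nz[of t] by (auto simp: U\<^sub>0_def)
    then show "2 \<le> norm (h t - h z0)"
      unfolding \<open>h z0 = 0\<close> by (simp add: h_def g_def norm_divide field_simps)
  qed (use z01 in auto)
  then have h_ball: "ball 0 2 \<subseteq> h ` ball 1 (1 / 2)" using \<open>h z0 = 0\<close> by simp
  have f_h: "f (Some (1 + \<delta> * t)) = (if h t = 0 then None else Some (1 + \<delta> / h t))"
    if "t \<in> ball 1 (1 / 2)" for t
    using f[OF bound[of t]] p_nz[of t] that by (auto simp: h_def)
  interpret pole_disc f 1 "ball 1 (norm \<delta> * (1 / 2))" U "1 + \<delta>" "norm \<delta> * (1 / 2)"
  proof
    show "continuous_map euclidean riemann_sphere (\<lambda>z. f (Some z))" "f None = None" "f (Some 1) = Some 1"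
      by fact+
    show "Some ` ball 1 (norm \<delta> * (1 / 2)) \<subseteq> attraction_basin f (Some 1)"
    proof -
      have "Some z \<in> attraction_basin f (Some 1)" if "z \<in> (\<lambda>t. 1 + \<delta> * t) ` ball 0 (1 / 2)" for z
        using that basin by auto
      then show ?thesis using ball_scale[of 0 "1 / 2"] by auto
    qed
    show "connected U"
    proof -
      have "(1 / 2 :: complex) \<in> cball 0 (1 / 2) \<inter> sphere 1 (1 / 2)" by (simp add: dist_norm)
      then have "cball 0 (1 / 2) \<inter> sphere 1 (1 / 2) \<noteq> ({} :: complex set)" by blast
      then have "connected U\<^sub>0"
        unfolding U\<^sub>0_def by (intro connected_Un connected_sphere) simp_all
      then show ?thesis
        unfolding U_def by (intro connected_continuous_image continuous_intros)
    qed
    show "1 \<in> U" unfolding U_def by (rule image_eqI[of _ _ 0]) (auto simp: U\<^sub>0_def)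
    show "Some ` U \<subseteq> attraction_basin f (Some 1)"
    proof -
      have "Some (1 + \<delta> * t) \<in> attraction_basin f (Some 1)" if "t \<in> U\<^sub>0" for t
      proof -
        have "f (Some (1 + \<delta> * t)) \<in> attraction_basin f (Some 1)"
          using f_g[OF that] basin[of "g t"] g_lt[OF that] by simp
        then show ?thesis by (simp add: attraction_basin_iff)
      qed
      then show ?thesis by (auto simp: U_def)
    qed
    show "sphere (1 + \<delta>) (norm \<delta> * (1 / 2)) \<subseteq> U"
    proof
      fix z assume z: "z \<in> sphere (1 + \<delta>) (norm \<delta> * (1 / 2))"
      have "1 - (z - 1) / \<delta> = (1 + \<delta> - z) / \<delta>" using \<delta> by (simp add: field_simps)
      then have "norm (1 - (z - 1) / \<delta>) = 1 / 2" using z \<delta> by (simp add: dist_norm norm_divide)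
      then have "(z - 1) / \<delta> \<in> U\<^sub>0" by (simp add: U\<^sub>0_def dist_norm)
      then show "z \<in> U" unfolding U_def using \<delta> by (intro image_eqI) auto
    qed
    show "f (Some z) \<noteq> Some 1" if "z \<in> ball (1 + \<delta>) (norm \<delta> * (1 / 2))" for z
    proof -
      have "z \<in> (\<lambda>t. 1 + \<delta> * t) ` ball 1 (1 / 2)" using that ball_scale[of 1 "1 / 2"] by simp
      then obtain t where "z = 1 + \<delta> * t" "t \<in> ball 1 (1 / 2)" by (rule imageE)
      then show ?thesis using f_h[of t] \<delta> by simp
    qed
    show "\<exists>z\<in>ball (1 + \<delta>) (norm \<delta> * (1 / 2)). f (Some z) = y" if "y \<notin> Some ` U" for y
    proof -
      have "\<exists>t\<in>ball 1 (1 / 2). f (Some (1 + \<delta> * t)) = y"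
      proof (cases y)
        case None
        then show ?thesis using f_h[OF z01(1)] z01(1) \<open>h z0 = 0\<close> by auto
      next
        case (Some w)
        define s where "s = (w - 1) / \<delta>"
        have w: "w = 1 + \<delta> * s" using \<delta> by (simp add: s_def)
        have "s \<notin> U\<^sub>0" using that by (auto simp: Some U_def w)
        then have "norm s > 1 / 2" by (auto simp: U\<^sub>0_def)
        moreover from this have "s \<noteq> 0" by auto
        ultimately have "1 / s \<in> ball 0 2" "s \<noteq> 0" by (simp_all add: norm_divide pos_divide_less_eq)
        then obtain t where t: "t \<in> ball 1 (1 / 2)" "h t = 1 / s" using h_ball by (metis imageE subsetD)
        then show ?thesis using f_h[OF t(1)] \<open>s \<noteq> 0\<close> by (auto simp: Some w)
      qed
      then obtain t where t: "t \<in> ball 1 (1 / 2)" "f (Some (1 + \<delta> * t)) = y" by blast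
      from t(1) have "1 + \<delta> * t \<in> (\<lambda>t. 1 + \<delta> * t) ` ball 1 (1 / 2)" by (rule imageI)
      with t(2) show ?thesis unfolding ball_scale by auto
    qed
    show "open {w. Some w \<in> (\<lambda>z. f (Some z)) ` C}"
      if C: "open C" "C \<subseteq> ball (1 + \<delta>) (norm \<delta> * (1 / 2))" "None \<notin> (\<lambda>z. f (Some z)) ` C" for C
    proof -
      define C' where "C' = (\<lambda>t. 1 + \<delta> * t) -` C"
      have C_eq: "C = (\<lambda>t. 1 + \<delta> * t) ` C'"
      proof -
        have "z \<in> (\<lambda>t. 1 + \<delta> * t) ` C'" if "z \<in> C" for z
          using \<delta> that by (intro image_eqI[of _ _ "(z - 1) / \<delta>"]) (auto simp: C'_def)
        then show ?thesis by (auto simp: C'_def)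
      qed
      have "open C'" unfolding C'_def using C(1) by (intro open_vimage continuous_intros)
      have "C' \<subseteq> ball 1 (1 / 2)"
      proof
        fix t assume "t \<in> C'"
        then have "1 + \<delta> * t \<in> (\<lambda>t. 1 + \<delta> * t) ` ball 1 (1 / 2)"
          using C(2) ball_scale[of 1 "1 / 2"] by (auto simp: C'_def)
        then show "t \<in> ball 1 (1 / 2)" using \<delta> by auto
      qed
      have hC: "open (h ` C')"
        using open_mapping_thm[OF h_hol' _ _ \<open>open C'\<close> \<open>C' \<subseteq> ball 1 (1 / 2)\<close> nonconst] by simp
      have f_C: "h t \<noteq> 0 \<and> f (Some (1 + \<delta> * t)) = Some (1 + \<delta> / h t)" if "t \<in> C'" for t
      proof -
        have "f (Some (1 + \<delta> * t)) \<noteq> None" using C(3) that unfolding C_eq by (metis image_eqI)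
        then show ?thesis using f_h[of t] \<open>C' \<subseteq> ball 1 (1 / 2)\<close> that by (auto split: if_splits)
      qed
      \<comment> \<open>Solving \<open>w = 1 + \<delta> / h t\<close> for \<open>h t\<close>
        exhibits the image as a preimage of the open image of \<open>C'\<close> under
        \<open>h\<close>.\<close>
      have "open (- {1} \<inter> (\<lambda>w. \<delta> / (w - 1)) -` (h ` C'))"
        using hC by (intro continuous_open_preimage continuous_intros) auto
      also have "- {1} \<inter> (\<lambda>w. \<delta> / (w - 1)) -` (h ` C') = {w. Some w \<in> (\<lambda>z. f (Some z)) ` C}"
      proof (intro equalityI subsetI)
        fix w assume "w \<in> - {1} \<inter> (\<lambda>w. \<delta> / (w - 1)) -` (h ` C')"
        then obtain t where t: "t \<in> C'" "\<delta> / (w - 1) = h t" "w \<noteq> 1" by blast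
        then have "f (Some (1 + \<delta> * t)) = Some w"
          using f_C[OF t(1)] \<delta> by (simp add: t(2)[symmetric])
        then show "w \<in> {w. Some w \<in> (\<lambda>z. f (Some z)) ` C}"
          using t(1) unfolding C_eq by (auto simp: image_image intro!: image_eqI[of _ _ t])
      next
        fix w assume "w \<in> {w. Some w \<in> (\<lambda>z. f (Some z)) ` C}"
        then obtain t where t: "t \<in> C'" "Some w = f (Some (1 + \<delta> * t))" unfolding C_eq by auto
        then have "w = 1 + \<delta> / h t" "h t \<noteq> 0" using f_C[OF t(1)] by auto
        then show "w \<in> - {1} \<inter> (\<lambda>w. \<delta> / (w - 1)) -` (h ` C')"
          using t(1) \<delta> by auto
      qed
      finally show ?thesis .
    qed
  qed (use \<delta> in auto)
  show ?thesis by (rule infinitely_connected_immediate_basin)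
qed

section \<open>The Chebyshev--Halley family near the root\<close>

text \<open>Continuity is uniform on a compact product, so the limit at parameter \<open>0\<close>
  controls all \<open>t\<close> in \<open>T\<close> at once; the closed unit disc serves as a
  compact range of parameters.\<close>

lemma uniformly_near_parameter_0:
  fixes \<phi> :: "complex \<times> complex \<Rightarrow> complex" and T :: "complex set"
  assumes cont: "continuous_on UNIV \<phi>" and T: "compact T" and \<epsilon>: "\<epsilon> > 0"
  shows "\<exists>r>0. \<forall>d t. norm d < r \<longrightarrow> t \<in> T \<longrightarrow> norm (\<phi> (d, t) - \<phi> (0, t)) < \<epsilon>"
proof -
  have "uniformly_continuous_on (cball 0 1 \<times> T) \<phi>"
    using cont T by (intro compact_uniformly_continuous compact_Times) (auto intro: continuous_on_subset)
  then obtain r where r: "r > 0"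
    "\<And>x y. x \<in> cball 0 1 \<times> T \<Longrightarrow> y \<in> cball 0 1 \<times> T \<Longrightarrow> dist y x < r \<Longrightarrow> dist (\<phi> y) (\<phi> x) < \<epsilon>"
    using \<epsilon> unfolding uniformly_continuous_on_def by metis
  show ?thesis
  proof (intro exI[of _ "min r 1"] conjI allI impI)
    fix d t :: complex assume "norm d < min r 1" "t \<in> T"
    then show "norm (\<phi> (d, t) - \<phi> (0, t)) < \<epsilon>"
      using r(2)[of "(0, t)" "(d, t)"] by (simp add: dist_Pair_Pair dist_norm)
  qed (use r in auto)
qed

text \<open>The sum is the derivative of \<open>1 + z + ... + z ^ m\<close>; the right-hand side has
  a double zero at \<open>1\<close>.\<close>

lemma power_sum_double_root:
  fixes z :: "'a::comm_ring_1"
  shows "(\<Sum>k<m. of_nat (Suc k) * z ^ k) * (z - 1)\<^sup>2 = of_nat m * z ^ Suc m - of_nat (Suc m) * z ^ m + 1"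
proof (induction m)
  case (Suc m)
  have "(\<Sum>k<Suc m. of_nat (Suc k) * z ^ k) * (z - 1)\<^sup>2
      = of_nat m * z ^ Suc m - of_nat (Suc m) * z ^ m + 1 + of_nat (Suc m) * z ^ m * (z - 1)\<^sup>2"
    using Suc by (simp add: distrib_right)
  then show ?case by (simp add: power2_eq_square algebra_simps)
qed simp

lemma sum_Suc_eq: "2 * (\<Sum>k<m. of_nat (Suc k)) = (of_nat (Suc m) * of_nat m :: 'a::comm_ring_1)"
  by (induction m) (simp_all add: algebra_simps)

text \<open>
  The polynomials \<open>S\<close>, \<open>V\<close> and \<open>E\<close> split off the triple zero at \<open>1\<close> of numerator minus
  denominator.
\<close>

lemma root_quotients:
  fixes n :: nat
  assumes n: "n \<ge> 2"
  defines "N \<equiv> of_nat n"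
  obtains S V E :: "complex poly" where
    "poly S 1 = N" "2 * poly V 1 = N * (N - 1)"
    "\<And>z. (z - 1) * poly S z = z ^ n - 1"
    "\<And>z. (z - 1)\<^sup>2 * poly V z = (N - 1) * z ^ n - N * z ^ (n - 1) + 1"
    "\<And>z. (z - 1) * poly E z = (N - 1) * (poly S z)\<^sup>2 - 2 * N * z ^ n * poly V z"
proof -
  define m where "m = n - 1"
  have m: "n = Suc m" using n by (simp add: m_def)
  have N: "of_nat m = N - 1" "of_nat (Suc m) = N" by (simp_all add: N_def m)
  define S V :: "complex poly" where "S = (\<Sum>k<n. monom 1 k)"
    and "V = (\<Sum>k<m. monom (of_nat (Suc k)) k)"
  have S: "poly S z = (\<Sum>k<n. z ^ k)" for z by (simp add: S_def poly_sum poly_monom)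
  have V: "poly V z = (\<Sum>k<m. of_nat (Suc k) * z ^ k)" for z
    by (simp add: V_def poly_sum poly_monom)
  have V1: "2 * poly V 1 = N * (N - 1)"
    using sum_Suc_eq[where 'a = complex, of m] by (simp only: V N power_one mult_1_right)
  have S1: "poly S 1 = N" by (simp add: S N_def)
  \<comment> \<open>Both terms of \<open>W\<close> equal \<open>(N - 1) * N\<^sup>2\<close> at
    \<open>1\<close>, so \<open>W\<close> vanishes there and a linear factor splits off. This is the
    source of the third zero.\<close>
  define W where "W = smult (N - 1) (S\<^sup>2) - smult (2 * N) (monom 1 n * V)"
  have "poly W 1 = (N - 1) * N\<^sup>2 - N * (2 * poly V 1)"
    by (simp add: W_def S1 poly_monom)
  also have "\<dots> = 0" by (simp only: V1) (simp add: power2_eq_square algebra_simps)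
  finally obtain E where W: "W = [:- 1, 1:] * E"
    by (auto simp: poly_eq_0_iff_dvd dvd_def)
  have E: "poly W z = (z - 1) * poly E z" for z unfolding W poly_mult by simp
  show thesis
  proof (rule that[OF S1 V1])
    show "(z - 1) * poly S z = z ^ n - 1" for z
      by (simp add: S power_diff_1_eq)
    show "(z - 1)\<^sup>2 * poly V z = (N - 1) * z ^ n - N * z ^ (n - 1) + 1" for z
      using power_sum_double_root[of z m] by (simp only: V N m diff_Suc_1 mult.commute)
    show "(z - 1) * poly E z = (N - 1) * (poly S z)\<^sup>2 - 2 * N * z ^ n * poly V z" for z
      by (simp add: E[symmetric] W_def poly_monom)
  qed
qed

section \<open>Explicit numerator and denominator in the scaled coordinate\<close>

definition ch_num :: "nat \<Rightarrow> complex \<Rightarrow> complex poly" where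
  "ch_num n \<alpha> = (let N = of_nat n in [:(1 - 2 * \<alpha>) * (N - 1):]
        + monom (2 - 4 * \<alpha> - 4 * N + 6 * \<alpha> * N - 2 * \<alpha> * N ^ 2) n
        + monom ((N - 1) * (1 - 2 * \<alpha> - 2 * N + 2 * \<alpha> * N)) (2 * n))"

definition ch_den :: "nat \<Rightarrow> complex \<Rightarrow> complex poly" where
  "ch_den n \<alpha> = (let N = of_nat n in
     monom (2 * N) (n - 1) * ([:\<alpha> * (1 - N):] + monom (- \<alpha> - N + \<alpha> * N) n))"

lemma ch_map_eq:
  assumes "n \<ge> 2"
  shows "ch_map n \<alpha> = rational_map (Fract (ch_num n \<alpha>) (ch_den n \<alpha>))"
  using chebyshev_halley_explicit[OF assms, of \<alpha>] by (simp add: ch_map_def ch_num_def ch_den_def Let_def)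

lemma degree_ch_den: 
  assumes "n \<ge> 2"
  shows "degree (ch_den n \<alpha>) \<le> 2 * n - 1"
proof -
  have "degree (ch_den n \<alpha>) \<le> (n - 1) + n"
    unfolding ch_den_def Let_def
    by (intro order.trans[OF degree_mult_le] add_mono degree_monom_le degree_add_le) auto
  then show ?thesis using assms by linarith
qed

lemma degree_ch_num:
  assumes n: "n \<ge> 2" and "1 - 2 * \<alpha> - 2 * of_nat n + 2 * \<alpha> * of_nat n \<noteq> 0"
  shows "2 * n \<le> degree (ch_num n \<alpha>)"
proof (rule le_degree)
  have "(of_nat n :: complex) \<noteq> 1" using n by simp
  moreover have "coeff (ch_num n \<alpha>) (2 * n) = 
      (of_nat n - 1) * (1 - 2 * \<alpha> - 2 * of_nat n + 2 * \<alpha> * of_nat n)"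
    using n by (auto simp: ch_num_def Let_def coeff_pCons split: nat.splits)
  ultimately show "coeff (ch_num n \<alpha>) (2 * n) \<noteq> 0" using assms(2) by simp
qed

text \<open>In both expressions \<alpha> can be collected into the factor
  \<open>(N - 1) * \<alpha>\<close>, which the normalisation cancels against one power of \<delta>
  supplied by \<open>z t - 1 = \<delta> * t\<close>. The triple zero of the difference thus leaves
  \<open>\<delta>\<^sup>2 * t ^ 3\<close>.\<close>

lemma ch_map_near_root:
  fixes n :: nat and \<delta> :: complex and S V E :: "complex poly"
  assumes n: "n \<ge> 2" and \<delta>: "\<delta> \<noteq> 0" "(of_nat n - 1) * \<alpha> * \<delta> = 1"
  defines "N \<equiv> of_nat n"
  assumes S: "\<And>z. (z - 1) * poly S z = z ^ n - 1"
    and V: "\<And>z. (z - 1)\<^sup>2 * poly V z = (N - 1) * z ^ n - N * z ^ (n - 1) + 1"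
    and E: "\<And>z. (z - 1) * poly E z = (N - 1) * (poly S z)\<^sup>2 - 2 * N * z ^ n * poly V z"
  defines "z \<equiv> \<lambda>t. 1 + \<delta> * t"
  shows "poly (ch_den n \<alpha>) (z t) = 2 * N * z t ^ (n - 1) * (t * poly S (z t) - N * z t ^ n)" (is ?den)
    and "poly (ch_num n \<alpha>) (z t) - poly (ch_den n \<alpha>) (z t) =
      \<delta>\<^sup>2 * t ^ 3 * (2 * poly S (z t) * poly V (z t) + \<delta> * poly E (z t))" (is ?diff)
proof -
  define x y s v e u where defs: "x = z t ^ n" "y = z t ^ (n - 1)" "s = poly S (z t)"
    "v = poly V (z t)" "e = poly E (z t)" "u = \<delta> * t"
  have rels: "u * s = x - 1" "u\<^sup>2 * v = (N - 1) * x - N * y + 1" "u * e = (N - 1) * s\<^sup>2 - 2 * N * x * v"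
    using S[of "z t"] V[of "z t"] E[of "z t"] by (simp_all add: defs z_def)
  have \<alpha>: "(N - 1) * \<alpha> * \<delta> = 1" using \<delta>(2) by (simp add: N_def)
  have den: "poly (ch_den n \<alpha>) (z t) = 2 * N * y * (\<alpha> * (1 - N) + (- \<alpha> - N + \<alpha> * N) * x)"
    by (simp add: ch_den_def Let_def poly_monom defs N_def)
  have "\<alpha> * (1 - N) + (- \<alpha> - N + \<alpha> * N) * x = (N - 1) * \<alpha> * (x - 1) - N * x"
    by (simp add: algebra_simps)
  also have "\<dots> = ((N - 1) * \<alpha> * \<delta>) * t * s - N * x"
    by (simp add: rels(1)[symmetric] defs(6) mult_ac)
  finally have D: "\<alpha> * (1 - N) + (- \<alpha> - N + \<alpha> * N) * x = t * s - N * x"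
    by (simp add: \<alpha>)
  show ?den using den D by (simp add: defs)
  have x2: "z t ^ (2 * n) = x\<^sup>2" by (simp add: defs power_mult mult.commute flip: power_mult)
  have num: "poly (ch_num n \<alpha>) (z t) = (1 - 2 * \<alpha>) * (N - 1)
      + (2 - 4 * \<alpha> - 4 * N + 6 * \<alpha> * N - 2 * \<alpha> * N ^ 2) * x
      + (N - 1) * (1 - 2 * \<alpha> - 2 * N + 2 * \<alpha> * N) * x\<^sup>2"
    by (simp add: ch_num_def Let_def poly_monom N_def x2) (simp add: defs)
  \<comment> \<open>The terms with \<alpha> are separated from the others. The first group has the
    factor \<open>u ^ 3\<close> by the relations for \<open>s\<close> and \<open>v\<close>; the
    second obtains its third factor from the relation for \<open>e\<close>.\<close>
  have "poly (ch_num n \<alpha>) (z t) - poly (ch_den n \<alpha>) (z t) =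
      2 * \<alpha> * (N - 1) * ((x - 1) * ((N - 1) * x - N * y + 1))
      + ((N - 1) * (x - 1)\<^sup>2 - 2 * N * x * ((N - 1) * x - N * y + 1))"
    unfolding num den by algebra
  also have "\<dots> = 2 * \<alpha> * (N - 1) * (u * s * (u\<^sup>2 * v)) + u\<^sup>2 * (u * e)"
    unfolding rels(3) by (simp add: rels(1,2)[symmetric]) algebra
  also have "\<dots> = 2 * ((N - 1) * \<alpha> * \<delta>) * \<delta>\<^sup>2 * t ^ 3 * s * v + \<delta> ^ 3 * t ^ 3 * e"
    by (simp add: defs(6) power2_eq_square power3_eq_cube mult_ac)
  also have "\<dots> = \<delta>\<^sup>2 * t ^ 3 * (2 * s * v + \<delta> * e)"
    unfolding \<alpha> by (simp add: power2_eq_square power3_eq_cube algebra_simps)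
  finally show ?diff by (simp add: defs)
qed

section \<open>Estimates for small \<delta>\<close>

lemma ch_map_infinitely_connected:
  fixes n :: nat
  assumes n: "n \<ge> 2"
  shows "\<exists>r>0. \<forall>\<alpha> \<delta>. \<delta> \<noteq> 0 \<longrightarrow> norm \<delta> < r \<longrightarrow> (of_nat n - 1) * \<alpha> * \<delta> = 1 \<longrightarrow>
    infinitely_connected (immediate_basin (ch_map n \<alpha>) (Some 1))"
proof -
  define N :: complex where "N = of_nat n"
  define \<nu> where "\<nu> = real n"
  have \<nu>: "\<nu> \<ge> 2" "norm N = \<nu>" and N_\<nu>: "N = of_real \<nu>" using n by (simp_all add: \<nu>_def N_def)
  obtain S V E :: "complex poly" where
    S1: "poly S 1 = N" and V1: "2 * poly V 1 = N * (N - 1)" and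
    S: "\<And>z. (z - 1) * poly S z = z ^ n - 1" and
    V: "\<And>z. (z - 1)\<^sup>2 * poly V z = (N - 1) * z ^ n - N * z ^ (n - 1) + 1" and
    E: "\<And>z. (z - 1) * poly E z = (N - 1) * (poly S z)\<^sup>2 - 2 * N * z ^ n * poly V z"
    using root_quotients[OF n] unfolding N_def by metis
  \<comment> \<open>\<open>D\<close> and \<open>G\<close> are the factors of the denominator and of
    the difference as functions of parameter and coordinate. At parameter \<open>0\<close> they
    become \<open>N * (t - 1)\<close> and the constant \<gamma>, the limiting model with its pole at
    \<open>1\<close>.\<close>
  define D where "D = (\<lambda>(d, t). t * poly S (1 + d * t) - N * (1 + d * t) ^ n)"
  define G where "G = (\<lambda>(d, t). 2 * poly S (1 + d * t) * poly V (1 + d * t) + d * poly E (1 + d * t))"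
  have D0: "D (0, t) = N * (t - 1)" for t by (simp add: D_def S1 algebra_simps)
  define \<gamma> where "\<gamma> = \<nu> * (\<nu> * (\<nu> - 1))"
  have \<gamma>: "\<gamma> > 0" using \<nu> by (simp add: \<gamma>_def)
  have G0: "G (0, t) = of_real \<gamma>" for t
  proof -
    have "G (0, t) = poly S 1 * (2 * poly V 1)" by (simp add: G_def)
    then show ?thesis unfolding V1 S1 by (simp add: N_\<nu> \<gamma>_def)
  qed
  have D_cont: "continuous_on UNIV D" and G_cont: "continuous_on UNIV G"
    unfolding D_def G_def case_prod_unfold by (intro continuous_intros)+
  obtain r1 where r1: "r1 > 0"
    "\<And>d t. norm d < r1 \<Longrightarrow> norm t \<le> 3 / 2 \<Longrightarrow> norm (D (d, t) - N * (t - 1)) < \<nu> / 8"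
    using uniformly_near_parameter_0[OF D_cont compact_cball[of 0 "3 / 2"], of "\<nu> / 8"] \<nu>(1)
    by (auto simp: D0)
  obtain r2 where r2: "r2 > 0"
    "\<And>d t. norm d < r2 \<Longrightarrow> norm t \<le> 3 / 2 \<Longrightarrow> norm (G (d, t) - of_real \<gamma>) < \<gamma> / 2"
    using uniformly_near_parameter_0[OF G_cont compact_cball[of 0 "3 / 2"], of "\<gamma> / 2"] \<gamma>
    by (auto simp: G0)
  \<comment> \<open>A lower bound for \<open>q\<close>: its factors are \<open>2 * N\<close>, a
    power of \<open>z t\<close> with \<open>norm (z t) \<ge> 1 / 2\<close>, and \<open>D\<close>,
    where \<open>\<nu> / 2 - \<nu> / 8 = 3 * \<nu> / 8\<close>.\<close>
  define \<kappa> where "\<kappa> = 2 * \<nu> * (1 / 2) ^ (n - 1) * (3 * \<nu> / 8)"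
  have \<kappa>: "\<kappa> > 0" using \<nu> by (simp add: \<kappa>_def)
  \<comment> \<open>The first two bounds keep \<open>D\<close> and \<open>G\<close> near their
    limits; \<open>1 / 3\<close> keeps \<open>z t\<close> away from \<open>0\<close>;
    \<open>1 / \<nu>\<close> keeps the top coefficient of the numerator nonzero; the last yields
    \<open>\<kappa> / (12 * \<gamma>) * (3 / 2 * \<gamma>) = \<kappa> / 8\<close>, the constant in
    the cubic bound.\<close>
  define r where "r = Min {r1, r2, 1 / 3, 1 / \<nu>, \<kappa> / (12 * \<gamma>)}"
  have r: "r > 0" "r \<le> r1" "r \<le> r2" "r \<le> 1 / 3" "r \<le> 1 / \<nu>" "r \<le> \<kappa> / (12 * \<gamma>)"
    using r1 r2 \<nu> \<kappa> \<gamma> by (auto simp: r_def)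
  have "infinitely_connected (immediate_basin (ch_map n \<alpha>) (Some 1))"
    if \<delta>: "\<delta> \<noteq> 0" "norm \<delta> < r" and \<alpha>: "(of_nat n - 1) * \<alpha> * \<delta> = 1" for \<alpha> \<delta>
  proof -
    define z where "z t = 1 + \<delta> * t" for t
    define P Q where "P = ch_num n \<alpha>" and "Q = ch_den n \<alpha>"
    define q where "q t = 2 * N * z t ^ (n - 1) * D (\<delta>, t)" for t
    define p where "p t = \<delta> * t ^ 3 * G (\<delta>, t)" for t
    have PQ: "poly Q (z t) = q t" "poly P (z t) - poly Q (z t) = \<delta> * p t" for t
      using ch_map_near_root[OF n \<delta>(1) \<alpha> S V[unfolded N_def] E[unfolded N_def], of t]
      by (simp_all add: P_def Q_def z_def q_def p_def D_def G_def N_def power2_eq_square)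
    have z: "1 / 2 \<le> norm (z t)" if "norm t \<le> 3 / 2" for t
    proof -
      have "norm (\<delta> * t) \<le> 1 / 3 * (3 / 2)"
        unfolding norm_mult using \<delta> r that by (intro mult_mono) auto
      then show ?thesis using norm_triangle_ineq4[of "z t" "\<delta> * t"] by (simp add: z_def)
    qed
    have D_near: "norm (D (\<delta>, t) - N * (t - 1)) < \<nu> / 8" if "norm t \<le> 3 / 2" for t
      using r1 r \<delta> that by auto
    have G_near: "norm (G (\<delta>, t) - of_real \<gamma>) < \<gamma> / 2" if "norm t \<le> 3 / 2" for t
      using r2 r \<delta> that by auto
    have G_nz: "G (\<delta>, t) \<noteq> 0" if "norm t \<le> 3 / 2" for t
      using G_near[OF that] \<gamma> by auto
    have G_le: "norm (G (\<delta>, t)) \<le> 3 / 2 * \<gamma>" if "norm t \<le> 3 / 2" for t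
      using G_near[OF that] \<gamma> norm_triangle_ineq[of "G (\<delta>, t) - of_real \<gamma>" "of_real \<gamma>"] by simp
    have D_ge: "3 * \<nu> / 8 \<le> norm (D (\<delta>, t))" if "norm t \<le> 3 / 2" "1 / 2 \<le> norm (t - 1)" for t
    proof -
      have "\<nu> * (1 / 2) \<le> norm (N * (t - 1))"
        unfolding norm_mult \<nu>(2) using that \<nu> by (intro mult_left_mono) auto
      then show ?thesis
        using D_near[OF that(1)] norm_triangle_ineq2[of "N * (t - 1)" "D (\<delta>, t)"]
        by (simp add: norm_minus_commute)
    qed
    have bound: "norm t \<le> 3 / 2" if "t \<in> cball 1 (1 / 2)" for t :: complex
      using that norm_triangle_ineq[of "t - 1" 1] by (simp add: dist_norm norm_minus_commute)
    have "N \<noteq> 0" using \<nu> by auto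
    have q_0: "q t = 0 \<longleftrightarrow> D (\<delta>, t) = 0" if "norm t \<le> 3 / 2" for t
      using z[OF that] \<open>N \<noteq> 0\<close> by (auto simp: q_def)
    have D_hol: "(\<lambda>t. D (\<delta>, t)) holomorphic_on X" for X
      unfolding D_def by (auto intro!: holomorphic_intros)
    have "norm (D (\<delta>, 1)) < \<nu> / 8" using D_near[of 1] by simp
    have D54: "norm (D (\<delta>, 5 / 4)) > \<nu> / 8"
    proof -
      have "norm (N * (5 / 4 - 1)) = \<nu> / 4" by (simp add: norm_mult \<nu>(2))
      then show ?thesis
        using D_near[of "5 / 4"] norm_triangle_ineq2[of "N * (5 / 4 - 1)" "D (\<delta>, 5 / 4)"]
        by (simp add: norm_minus_commute)
    qed
    \<comment> \<open>The zero of the limit at \<open>1\<close> persists: values on the circle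
      differ from \<open>D (\<delta>, 1)\<close> by at least
      \<open>3 * \<nu> / 8 - \<nu> / 8\<close>, while \<open>D (\<delta>, 1)\<close> is within
      \<open>\<nu> / 8\<close> of \<open>0\<close>.\<close>
    have "\<exists>t\<in>ball 1 (1 / 2). D (\<delta>, t) = 0"
    proof -
      have mem: "1 \<in> ball (1::complex) (1 / 2)" "5 / 4 \<in> ball (1::complex) (1 / 2)"
        by (simp_all add: dist_norm)
      have "ball (D (\<delta>, 1)) (\<nu> / 4) \<subseteq> (\<lambda>t. D (\<delta>, t)) ` ball 1 (1 / 2)"
      proof (rule ball_subset_holomorphic_image[OF D_hol holomorphic_on_imp_continuous_on[OF D_hol]])
        show "\<not> (\<lambda>t. D (\<delta>, t)) constant_on ball 1 (1 / 2)"
          using D54 \<open>norm (D (\<delta>, 1)) < \<nu> / 8\<close> mem unfolding constant_on_def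
          by (metis order_less_trans less_irrefl)
        fix t :: complex assume t: "t \<in> sphere 1 (1 / 2)"
        then have "3 * \<nu> / 8 \<le> norm (D (\<delta>, t))"
          using bound[of t] by (intro D_ge) (auto simp: dist_norm norm_minus_commute)
        then show "\<nu> / 4 \<le> norm (D (\<delta>, t) - D (\<delta>, 1))"
          using \<open>norm (D (\<delta>, 1)) < \<nu> / 8\<close> norm_triangle_ineq2[of "D (\<delta>, t)" "D (\<delta>, 1)"] by linarith
      qed (use \<nu> in auto)
      moreover have "0 \<in> ball (D (\<delta>, 1)) (\<nu> / 4)"
        using \<open>norm (D (\<delta>, 1)) < \<nu> / 8\<close> \<nu> by simp
      ultimately show ?thesis by (metis (no_types, lifting) imageE subsetD)
    qed
    then obtain a where a: "a \<in> ball 1 (1 / 2)" "D (\<delta>, a) = 0" by blast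
    have "Q \<noteq> 0"
    proof
      assume "Q = 0"
      then have "q (5 / 4) = 0" using PQ(1)[of "5 / 4"] by simp
      then show False using q_0[of "5 / 4"] D54 \<nu> by simp
    qed
    have f: "ch_map n \<alpha> (Some (z t)) = (if q t = 0 then None else Some (1 + \<delta> * (p t / q t)))"
      if "norm t \<le> 3 / 2" for t
    proof -
      \<comment> \<open>At a zero of \<open>D\<close> the coordinate is nonzero because
        \<open>D (\<delta>, 0) = - N\<close>, and the numerator there equals
        \<open>\<delta> * p t\<close>, which does not vanish.\<close>
      have "poly P (z t) \<noteq> 0" if "poly Q (z t) = 0"
      proof -
        have "D (\<delta>, t) = 0" using that q_0 PQ(1) \<open>norm t \<le> 3 / 2\<close> by simp
        then have "t \<noteq> 0" using \<open>N \<noteq> 0\<close> by (auto simp: D_def)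
        then show ?thesis using PQ(2)[of t] that \<delta>(1) G_nz \<open>norm t \<le> 3 / 2\<close> by (auto simp: p_def)
      qed
      moreover have "poly P (z t) / poly Q (z t) = 1 + \<delta> * (p t / q t)" if "q t \<noteq> 0"
        using PQ[of t] that by (simp add: field_simps)
      ultimately show ?thesis
        using rational_map_Fract_Some[OF _ \<open>Q \<noteq> 0\<close>, of "z t" P] PQ(1)[of t]
        by (simp add: ch_map_eq[OF n] flip: P_def Q_def)
    qed
    \<comment> \<open>A vanishing coefficient would give \<open>2 = (2 * N - 1) * \<delta>\<close>,
      whose right-hand side has modulus at most \<open>(2 * \<nu> - 1) / \<nu> < 2\<close>.\<close>
    have lead: "1 - 2 * \<alpha> - 2 * of_nat n + 2 * \<alpha> * of_nat n \<noteq> (0::complex)"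
    proof
      assume "1 - 2 * \<alpha> - 2 * of_nat n + 2 * \<alpha> * of_nat n = (0::complex)"
      then have "2 * ((of_nat n - 1) * \<alpha>) = 2 * N - 1" by (simp add: N_def algebra_simps)
      then have "2 * ((of_nat n - 1) * \<alpha> * \<delta>) = (2 * N - 1) * \<delta>" by (metis mult.assoc)
      then have "2 = (2 * N - 1) * \<delta>" using \<alpha> by simp
      then have "2 = norm (2 * N - 1) * norm \<delta>" by (metis norm_mult norm_numeral)
      also have "2 * N - 1 = of_real (2 * \<nu> - 1)" by (simp add: N_\<nu>)
      also have "norm (of_real (2 * \<nu> - 1) :: complex) = 2 * \<nu> - 1" using \<nu> by (simp only: norm_of_real)
      also have "(2 * \<nu> - 1) * norm \<delta> \<le> (2 * \<nu> - 1) * (1 / \<nu>)"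
        using \<delta> r \<nu> by (intro mult_left_mono) auto
      also have "\<dots> < 2" using \<nu> by (simp add: field_simps)
      finally show False by simp
    qed
    show ?thesis
    proof (rule infinitely_connected_immediate_basin_scaled[of "ch_map n \<alpha>" \<delta> q p])
      show "continuous_map euclidean riemann_sphere (\<lambda>z. ch_map n \<alpha> (Some z))"
        by (simp add: ch_map_def continuous_map_rational_map)
      have "degree P > degree Q"
        using degree_ch_den[OF n, of \<alpha>] degree_ch_num[OF n lead] n by (simp add: P_def Q_def)
      then show "ch_map n \<alpha> None = None"
        using \<open>Q \<noteq> 0\<close> by (simp add: ch_map_eq[OF n] P_def Q_def rational_map_Fract_None)
      show "ch_map n \<alpha> (Some (1 + \<delta> * t)) = (if q t = 0 then None else Some (1 + \<delta> * (p t / q t)))"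
        if "norm t \<le> 3 / 2" for t using f[OF that] by (simp add: z_def)
      show "p holomorphic_on UNIV" "q holomorphic_on UNIV"
        unfolding p_def q_def z_def D_def G_def by (auto intro!: holomorphic_intros)
      show "p t \<noteq> 0" if "norm t \<le> 3 / 2" "t \<noteq> 0" for t
        using that \<delta> G_nz by (simp add: p_def)
      show "q t \<noteq> 0 \<and> norm (p t) \<le> norm t ^ 3 / 8 * norm (q t)"
        if t: "t \<in> cball 0 (1 / 2) \<union> sphere 1 (1 / 2)" for t
      proof -
        have t1: "norm t \<le> 3 / 2" using t bound[of t] by auto
        have t2: "1 / 2 \<le> norm (t - 1)"
          using t norm_triangle_ineq2[of 1 t] by (auto simp: dist_norm norm_minus_commute)
        have "\<kappa> \<le> norm (q t)"
          unfolding \<kappa>_def q_def norm_mult norm_power \<nu>(2) norm_numeral using z[OF t1] D_ge[OF t1 t2] \<nu>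
          by (intro mult_mono power_mono) auto
        moreover have "norm \<delta> * norm (G (\<delta>, t)) \<le> \<kappa> / (12 * \<gamma>) * (3 / 2 * \<gamma>)"
          using \<delta> r G_le[OF t1] \<gamma> by (intro mult_mono) auto
        ultimately have *: "norm \<delta> * norm (G (\<delta>, t)) \<le> norm (q t) / 8"
          using \<gamma> by (simp add: field_simps)
        have "norm (p t) = norm t ^ 3 * (norm \<delta> * norm (G (\<delta>, t)))"
          by (simp add: p_def norm_mult norm_power)
        also have "\<dots> \<le> norm t ^ 3 * (norm (q t) / 8)"
          using * by (intro mult_left_mono) auto
        finally show ?thesis using \<open>\<kappa> \<le> norm (q t)\<close> \<kappa> by auto
      qed
      show "\<exists>t\<in>ball 1 (1 / 2). q t = 0"
        using a q_0 bound by (metis ball_subset_cball subsetD)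
      show "\<exists>t\<in>ball 1 (1 / 2). q t \<noteq> 0"
        using q_0[of "5 / 4"] D54 \<nu> by (intro bexI[of _ "5 / 4"]) (auto simp: dist_norm)
    qed (use \<delta> in auto)
  qed
  then show ?thesis using r(1) by blast
qed

theorem theoremB:
  fixes n :: nat
  assumes "n \<ge> 2"
  shows "\<exists>\<alpha>\<^sub>0::real. \<alpha>\<^sub>0 > 0 \<and>
    (\<forall>\<alpha>::real. \<alpha> > \<alpha>\<^sub>0 \<longrightarrow>
       infinitely_connected (immediate_basin (ch_map n (complex_of_real \<alpha>)) (Some 1))) \<and>
    (n = 2 \<longrightarrow>
       (\<forall>\<alpha>::complex. norm \<alpha> > \<alpha>\<^sub>0 \<longrightarrow>
          infinitely_connected (immediate_basin (ch_map 2 \<alpha>) (Some 1))))"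
proof -
  obtain r where r: "r > 0" "\<And>\<alpha> \<delta>. \<delta> \<noteq> 0 \<Longrightarrow> norm \<delta> < r \<Longrightarrow> (of_nat n - 1) * \<alpha> * \<delta> = 1 \<Longrightarrow>
    infinitely_connected (immediate_basin (ch_map n \<alpha>) (Some 1))"
    using ch_map_infinitely_connected[OF assms] by blast
  \<comment> \<open>With \<open>\<delta> = 1 / ((n - 1) * \<alpha>)\<close> and
    \<open>n - 1 \<ge> 1\<close>, the bound \<open>norm \<alpha> > 1 / r\<close> forces
    \<open>norm \<delta> < r\<close>. A bound on the modulus serves the real and the complex clause
    alike.\<close>
  have "infinitely_connected (immediate_basin (ch_map n \<alpha>) (Some 1))"
    if \<alpha>: "norm \<alpha> > 1 / r" for \<alpha> :: complex
  proof -
    have pos: "norm \<alpha> > 0" using \<alpha> r(1) by (smt (verit) divide_pos_pos)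
    have n1: "norm (of_nat n - 1 :: complex) \<ge> 1"
    proof -
      have "(of_nat n - 1 :: complex) = of_nat (n - 1)" using assms by (simp add: of_nat_diff)
      then show ?thesis using assms by (simp only: norm_of_nat)
    qed
    then have nz: "(of_nat n - 1 :: complex) * \<alpha> \<noteq> 0" using pos by auto
    have "1 * norm \<alpha> \<le> norm (of_nat n - 1 :: complex) * norm \<alpha>"
      using n1 by (intro mult_right_mono) auto
    then have "1 / r < norm ((of_nat n - 1) * \<alpha>)" using \<alpha> by (simp add: norm_mult)
    then have "norm (1 / ((of_nat n - 1) * \<alpha>)) < r"
      using r(1) nz by (simp only: norm_divide norm_one) (simp add: field_simps)
    then show ?thesis using nz by (intro r(2)[of "1 / ((of_nat n - 1) * \<alpha>)"]) auto
  qed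
  then show ?thesis using r(1) by (intro exI[of _ "1 / r"]) auto
qed

end
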